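(* Let $X,Y$ be non-empty proper metric spaces on which a group $\Gamma$ acts as isometries. Let $\Pi_1$ be an abstract pattern space over $(X,\Gamma)$ and $\Pi_2$ an abstract pattern space over $(Y,\Gamma)$. For two abstract patterns $\mathcal{P}_1\in\Pi_1$ and $\mathcal{P}_2\in\Pi_2$, consider the following three conditions: (1) There exist $x_0\in X$, $y_0\in Y$ and $R_0\geqq0$ such that if $\gamma,\eta\in\Gamma$, $R\geqq0$ and $(\gamma\mathcal{P}_1)\wedge B(x_0,R+R_0)=(\eta\mathcal{P}_1)\wedge B(x_0,R+R_0)$, then $(\gamma\mathcal{P}_2)\wedge B(y_0,R)=(\eta\mathcal{P}_2)\wedge B(y_0,R)$. (2) For any $x_1\in X$ and $y_1\in Y$ there exists $R_1\geqq0$ such that if $\gamma,\eta\in\Gamma$, $R\geqq0$ and $(\gamma\mathcal{P}_1)\wedge B(x_1,R+R_1)=(\eta\mathcal{P}_1)\wedge B(x_1,R+R_1)$, then $(\gamma\mathcal{P}_2)\wedge B(y_1,R)=(\eta\mathcal{P}_2)\wedge B(y_1,R)$. (3) For any compact $K_2\subset Y$ there exists a compact $K_1\subset X$ such that $\gamma,\eta\in\Gamma$ and $(\gamma\mathcal{P}_1)\wedge K_1=(\eta\mathcal{P}_1)\wedge K_1$ imply $(\gamma\mathcal{P}_2)\wedge K_2=(\eta\mathcal{P}_2)\wedge K_2$. Then conditions (1) and (2) are always equivalent, and (1) and (2) always imply (3). If the action of $\Gamma$ on $Y$ is transitive, $\Pi_2$ is glueable, $X=Y$ (with the same metric and $\Gamma$-action)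 and $\mathcal{P}_2$ consists of bounded components, then (3) implies (1) and (2).
   Context: $B(x,r)$ denotes the closed ball; proper means all closed balls are compact; $\mathrm{Cl}(X)$ is the set of closed subsets of $X$. Abstract pattern space over $(X,\Gamma)$ ($\Gamma$ acting on $X$ by homeomorphisms): a non-empty set $\Pi$ with a map $\Pi\times\mathrm{Cl}(X)\to\Pi$, $(\mathcal{P},C)\mapsto\mathcal{P}\wedge C$ and an action of $\Gamma$ on $\Pi$ such that (i) $(\mathcal{P}\wedge C_1)\wedge C_2=\mathcal{P}\wedge(C_1\cap C_2)$; (ii) for each $\mathcal{P}$ there is a (unique) closed set $\operatorname{supp}\mathcal{P}$ with $\mathcal{P}\wedge C=\mathcal{P}\iff C\supset\operatorname{supp}\mathcal{P}$ for all closed $C$; (iii) $(\gamma\mathcal{P})\wedge(\gamma C)=\gamma(\mathcal{P}\wedge C)$. Glueing: $\mathcal{P}\geqq\mathcal{Q}$ means $\mathcal{P}\wedge\operatorname{supp}\mathcal{Q}=\mathcal{Q}$ (a partial order); $\bigvee\Xi$ is the supremum. $\Xi\wedge C=\{\mathcal{P}\wedge C\mid\mathcal{P}\in\Xi\}$. $\Xi\subset\Pi$ is pairwise compatible if for any $\mathcal{P},\mathcal{Q}\in\Xi$ some $\mathcal{R}\in\Pi$ satisfies $\mathcal{R}\geqq\mathcal{P}$ and $\mathcal{R}\geqq\mathcal{Q}$; locally finite if $\Xi\wedge B(x,r)$ is finite for all $x$ and $r>0$. $\Pi$ is glueable if every locally finite, pairwise compatible $\Xi\subset\Pi$ has a supremum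 and $\bigvee(\Xi\wedge C)=(\bigvee\Xi)\wedge C$ for all closed $C$. Bounded components: $\mathcal{P}$ consists of bounded components if there is $R_{\mathcal P}>0$ such that for every closed $C$ and every $x\in\operatorname{supp}(\mathcal{P}\wedge C)$ we have $x\in\operatorname{supp}(\mathcal{P}\wedge C\wedge B(x,R_{\mathcal P}))$. *)

theory Defs
  imports "HOL-Analysis.Analysis" "HOL-Algebra.Group_Action"
begin

text \<open>
  The spaces \<open>X\<close> and \<open>Y\<close> are types of class \<^class>\<open>metric_space\<close> (hence non-empty); the group and
  the sets of patterns have explicit carriers. The cutting-off map is total on subsets of the
  space, but only its values at closed sets are ever constrained or used.
\<close>

text \<open>The set \<open>S\<close> is unique in an abstract pattern space; see \<open>supp_unique\<close> below.\<close>

definition supp :: "('p \<Rightarrow> 'x::topological_space set \<Rightarrow> 'p) \<Rightarrow> 'p \<Rightarrow> 'x set" where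
  "supp cutoff P = (THE S. closed S \<and> (\<forall>C. closed C \<longrightarrow> (cutoff P C = P \<longleftrightarrow> S \<subseteq> C)))"

locale abstract_pattern_space =
  space: group_action G UNIV act +
  patterns: group_action G Pat pact
  for G :: "('g, 'm) monoid_scheme" (structure)
    and act :: "'g \<Rightarrow> 'x::topological_space \<Rightarrow> 'x"
    and Pat :: "'p set"
    and cutoff :: "'p \<Rightarrow> 'x set \<Rightarrow> 'p"
    and pact :: "'g \<Rightarrow> 'p \<Rightarrow> 'p" +
  assumes act_homeo: "g \<in> carrier G \<Longrightarrow> homeomorphic_map euclidean euclidean (act g)"
    and nonempty: "Pat \<noteq> {}"
    and cutoff_in: "\<lbrakk>P \<in> Pat; closed C\<rbrakk> \<Longrightarrow> cutoff P C \<in> Pat"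
    and cutoff_cutoff: "\<lbrakk>P \<in> Pat; closed C1; closed C2\<rbrakk> \<Longrightarrow> cutoff (cutoff P C1) C2 = cutoff P (C1 \<inter> C2)"
    and ex_supp: "P \<in> Pat \<Longrightarrow> \<exists>S. closed S \<and> (\<forall>C. closed C \<longrightarrow> (cutoff P C = P \<longleftrightarrow> S \<subseteq> C))"
    and cutoff_equivariant:
      "\<lbrakk>g \<in> carrier G; P \<in> Pat; closed C\<rbrakk> \<Longrightarrow> cutoff (pact g P) (act g ` C) = pact g (cutoff P C)"
begin

lemma supp_unique:
  assumes "P \<in> Pat"
  shows "\<exists>!S. closed S \<and> (\<forall>C. closed C \<longrightarrow> (cutoff P C = P \<longleftrightarrow> S \<subseteq> C))"
  using ex_supp[OF assms] by (metis subset_antisym subset_refl)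

lemma
  assumes "P \<in> Pat"
  shows closed_supp: "closed (supp cutoff P)"
    and cutoff_eq_iff: "closed C \<Longrightarrow> cutoff P C = P \<longleftrightarrow> supp cutoff P \<subseteq> C"
  using theI'[OF supp_unique[OF assms]] unfolding supp_def by blast+

end

definition pattern_ge :: "('p \<Rightarrow> 'x::topological_space set \<Rightarrow> 'p) \<Rightarrow> 'p \<Rightarrow> 'p \<Rightarrow> bool" where
  "pattern_ge cutoff P Q \<longleftrightarrow> cutoff P (supp cutoff Q) = Q"

definition is_pattern_sup ::
    "'p set \<Rightarrow> ('p \<Rightarrow> 'x::topological_space set \<Rightarrow> 'p) \<Rightarrow> 'p set \<Rightarrow> 'p \<Rightarrow> bool" where
  "is_pattern_sup Pat cutoff \<Xi> S \<longleftrightarrow>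
     S \<in> Pat \<and> (\<forall>P\<in>\<Xi>. pattern_ge cutoff S P) \<and>
     (\<forall>R\<in>Pat. (\<forall>P\<in>\<Xi>. pattern_ge cutoff R P) \<longrightarrow> pattern_ge cutoff R S)"

definition pairwise_compatible ::
    "'p set \<Rightarrow> ('p \<Rightarrow> 'x::topological_space set \<Rightarrow> 'p) \<Rightarrow> 'p set \<Rightarrow> bool" where
  "pairwise_compatible Pat cutoff \<Xi> \<longleftrightarrow>
     (\<forall>P\<in>\<Xi>. \<forall>Q\<in>\<Xi>. \<exists>R\<in>Pat. pattern_ge cutoff R P \<and> pattern_ge cutoff R Q)"

definition locally_finite_patterns ::
    "('p \<Rightarrow> 'x::metric_space set \<Rightarrow> 'p) \<Rightarrow> 'p set \<Rightarrow> bool" where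
  "locally_finite_patterns cutoff \<Xi> \<longleftrightarrow>
     (\<forall>x r. r > 0 \<longrightarrow> finite ((\<lambda>P. cutoff P (cball x r)) ` \<Xi>))"

definition glueable :: "'p set \<Rightarrow> ('p \<Rightarrow> 'x::metric_space set \<Rightarrow> 'p) \<Rightarrow> bool" where
  "glueable Pat cutoff \<longleftrightarrow>
     (\<forall>\<Xi>\<subseteq>Pat. locally_finite_patterns cutoff \<Xi> \<and> pairwise_compatible Pat cutoff \<Xi> \<longrightarrow>
        (\<exists>S. is_pattern_sup Pat cutoff \<Xi> S \<and>
          (\<forall>C. closed C \<longrightarrow> is_pattern_sup Pat cutoff ((\<lambda>P. cutoff P C) ` \<Xi>) (cutoff S C))))"

definition bounded_components :: "('p \<Rightarrow> 'x::metric_space set \<Rightarrow> 'p) \<Rightarrow> 'p \<Rightarrow> bool" where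
  "bounded_components cutoff P \<longleftrightarrow>
     (\<exists>R>0. \<forall>C. closed C \<longrightarrow>
        (\<forall>x\<in>supp cutoff (cutoff P C). x \<in> supp cutoff (cutoff (cutoff P C) (cball x R))))"

definition proper_isometric_action ::
    "('g, 'm) monoid_scheme \<Rightarrow> ('g \<Rightarrow> 'x::metric_space \<Rightarrow> 'x) \<Rightarrow> bool" where
  "proper_isometric_action G act \<longleftrightarrow>
     (\<forall>(x::'x) r. compact (cball x r)) \<and>
     group_action G UNIV act \<and>
     (\<forall>g\<in>carrier G. \<forall>x y. dist (act g x) (act g y) = dist x y)"

text \<open>
  Three forms of local derivability of \<open>P2\<close> from \<open>P1\<close>: for some pair of base points, for all
  pairs of base points, and in terms of compact sets.
\<close>

definition derivable_some_base ::
    "('g, 'm) monoid_scheme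
      \<Rightarrow> ('p \<Rightarrow> 'x::metric_space set \<Rightarrow> 'p) \<Rightarrow> ('g \<Rightarrow> 'p \<Rightarrow> 'p) \<Rightarrow> 'p
      \<Rightarrow> ('q \<Rightarrow> 'y::metric_space set \<Rightarrow> 'q) \<Rightarrow> ('g \<Rightarrow> 'q \<Rightarrow> 'q) \<Rightarrow> 'q \<Rightarrow> bool" where
  "derivable_some_base G cutoff1 pact1 P1 cutoff2 pact2 P2 \<longleftrightarrow>
     (\<exists>x0 y0. \<exists>R0\<ge>0. \<forall>g\<in>carrier G. \<forall>h\<in>carrier G. \<forall>R\<ge>0.
        cutoff1 (pact1 g P1) (cball x0 (R + R0)) = cutoff1 (pact1 h P1) (cball x0 (R + R0)) \<longrightarrow>
        cutoff2 (pact2 g P2) (cball y0 R) = cutoff2 (pact2 h P2) (cball y0 R))"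

definition derivable_all_bases ::
    "('g, 'm) monoid_scheme
      \<Rightarrow> ('p \<Rightarrow> 'x::metric_space set \<Rightarrow> 'p) \<Rightarrow> ('g \<Rightarrow> 'p \<Rightarrow> 'p) \<Rightarrow> 'p
      \<Rightarrow> ('q \<Rightarrow> 'y::metric_space set \<Rightarrow> 'q) \<Rightarrow> ('g \<Rightarrow> 'q \<Rightarrow> 'q) \<Rightarrow> 'q \<Rightarrow> bool" where
  "derivable_all_bases G cutoff1 pact1 P1 cutoff2 pact2 P2 \<longleftrightarrow>
     (\<forall>x1 y1. \<exists>R1\<ge>0. \<forall>g\<in>carrier G. \<forall>h\<in>carrier G. \<forall>R\<ge>0.
        cutoff1 (pact1 g P1) (cball x1 (R + R1)) = cutoff1 (pact1 h P1) (cball x1 (R + R1)) \<longrightarrow>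
        cutoff2 (pact2 g P2) (cball y1 R) = cutoff2 (pact2 h P2) (cball y1 R))"

definition derivable_compact ::
    "('g, 'm) monoid_scheme
      \<Rightarrow> ('p \<Rightarrow> 'x::metric_space set \<Rightarrow> 'p) \<Rightarrow> ('g \<Rightarrow> 'p \<Rightarrow> 'p) \<Rightarrow> 'p
      \<Rightarrow> ('q \<Rightarrow> 'y::metric_space set \<Rightarrow> 'q) \<Rightarrow> ('g \<Rightarrow> 'q \<Rightarrow> 'q) \<Rightarrow> 'q \<Rightarrow> bool" where
  "derivable_compact G cutoff1 pact1 P1 cutoff2 pact2 P2 \<longleftrightarrow>
     (\<forall>K2. compact K2 \<longrightarrow> (\<exists>K1. compact K1 \<and> (\<forall>g\<in>carrier G. \<forall>h\<in>carrier G.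
        cutoff1 (pact1 g P1) K1 = cutoff1 (pact1 h P1) K1 \<longrightarrow>
        cutoff2 (pact2 g P2) K2 = cutoff2 (pact2 h P2) K2)))"

end

theory Submission
  imports Defs
begin

text \<open>
  The conditions on base points are equivalent by the triangle inequality: moving the base points
  costs their distances, which the additive constant absorbs. They imply the condition on compact
  sets because a compact set lies in a ball and balls in a proper space are compact.

  For the converse, apply the condition on compact sets to one ball \<open>cball x0 r\<close>, where \<open>r\<close> exceeds
  the radius \<open>\<rho>\<close> of the components of \<open>P2\<close>. It says that agreement of translates of \<open>P1\<close> on some
  \<open>cball x0 R0\<close> forces agreement of the translates of \<open>P2\<close> on \<open>cball x0 r\<close>. Since the action is
  transitive and isometric, the same holds with every other centre \<open>y\<close> and the same radii. So if
  \<open>g P1\<close> and \<open>h P1\<close> agree on \<open>cball x0 (R + R0)\<close>, then \<open>g P2\<close> and \<open>h P2\<close> agree on each small ball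
  \<open>cball y r\<close> with \<open>y\<close> in \<open>cball x0 R\<close>. It remains to pass from small balls to
  \<open>cball x0 R\<close> itself. Cut a translate of \<open>P2\<close> off at \<open>cball x0 R\<close> and call the result \<open>A\<close>. Because
  components are bounded, a point of the support of \<open>A\<close> survives in the piece of \<open>A\<close> on any ball
  that contains the \<open>\<rho>\<close>-ball about that point; finitely many balls \<open>cball y r\<close> suffice for all points,
  by compactness. By glueability these finitely many pieces have a supremum, and as it lies below \<open>A\<close>
  and has the whole support of \<open>A\<close>, it is \<open>A\<close> (\<open>pattern_sup_of_pieces\<close>). Both translates of \<open>P2\<close>
  have the same pieces, hence the same supremum (\<open>eq_if_locally_eq\<close>).
\<close>

section \<open>Supports, the order of patterns and translation\<close>

context abstract_pattern_space
begin

lemma supp_eqI: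
  assumes "P \<in> Pat" "closed S" "\<And>C. closed C \<Longrightarrow> cutoff P C = P \<longleftrightarrow> S \<subseteq> C"
  shows "supp cutoff P = S"
  using supp_unique[OF assms(1)] closed_supp[OF assms(1)] cutoff_eq_iff[OF assms(1)] assms(2,3)
  by blast

lemma supp_cutoff_subset:
  assumes "P \<in> Pat" "closed C"
  shows "supp cutoff (cutoff P C) \<subseteq> C"
  using assms cutoff_cutoff[OF assms(1) assms(2) assms(2)] cutoff_eq_iff[OF cutoff_in[OF assms] assms(2)]
  by simp

lemma pattern_ge_cutoff:
  assumes "P \<in> Pat" "closed C"
  shows "pattern_ge cutoff P (cutoff P C)"
proof -
  let ?Q = "cutoff P C"
  have Q: "?Q \<in> Pat" and cl: "closed (supp cutoff ?Q)"
    using assms by (auto intro: cutoff_in closed_supp)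
  have "?Q = cutoff ?Q (supp cutoff ?Q)"
    using cutoff_eq_iff[OF Q cl] by simp
  also have "\<dots> = cutoff P (C \<inter> supp cutoff ?Q)"
    using assms cl by (simp add: cutoff_cutoff)
  also have "C \<inter> supp cutoff ?Q = supp cutoff ?Q"
    using supp_cutoff_subset[OF assms] by blast
  finally show ?thesis by (simp add: pattern_ge_def)
qed

lemma supp_mono:
  assumes "P \<in> Pat" "Q \<in> Pat" "pattern_ge cutoff Q P"
  shows "supp cutoff P \<subseteq> supp cutoff Q"
proof -
  have cl: "closed (supp cutoff P)" "closed (supp cutoff Q)"
    using assms by (auto intro: closed_supp)
  have Q: "cutoff Q (supp cutoff Q) = Q"
    using assms cl by (simp add: cutoff_eq_iff)
  have P: "P = cutoff Q (supp cutoff P)"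
    using assms by (simp add: pattern_ge_def)
  \<comment> \<open>Cutting off at the two supports commutes, and cutting off \<open>Q\<close> at its own support is trivial.\<close>
  have "cutoff P (supp cutoff Q) = P"
    by (metis P Q assms(2) cl cutoff_cutoff inf_commute)
  then show ?thesis
    using assms cl by (simp add: cutoff_eq_iff)
qed

lemma supp_cutoff_mono:
  assumes "P \<in> Pat" "closed C" "closed D" "C \<subseteq> D"
  shows "supp cutoff (cutoff P C) \<subseteq> supp cutoff (cutoff P D)"
proof (rule supp_mono)
  have "cutoff P C = cutoff (cutoff P D) C"
    using assms by (simp add: cutoff_cutoff inf.absorb2)
  then show "pattern_ge cutoff (cutoff P D) (cutoff P C)"
    using pattern_ge_cutoff[OF cutoff_in[OF assms(1,3)] assms(2)] by simp
qed (use assms in \<open>auto intro: cutoff_in\<close>)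

lemma cutoff_eq_subset:
  assumes "P \<in> Pat" "Q \<in> Pat" "closed C" "closed D" "D \<subseteq> C" "cutoff P C = cutoff Q C"
  shows "cutoff P D = cutoff Q D"
  by (metis assms cutoff_cutoff inf.absorb2)

lemma pattern_ge_eqI:
  assumes "P \<in> Pat" "Q \<in> Pat" "pattern_ge cutoff P Q" "supp cutoff P \<subseteq> supp cutoff Q"
  shows "Q = P"
  using assms cutoff_eq_iff[OF assms(1) closed_supp[OF assms(2)]] by (simp add: pattern_ge_def)

text \<open>
  The supremum of pieces of \<open>A\<close> lies below \<open>A\<close> because \<open>A\<close> is an upper bound; once the pieces
  exhaust the support of \<open>A\<close>, there is no room left between the two.
\<close>

lemma pattern_sup_of_pieces:
  assumes "A \<in> Pat" "\<And>C. C \<in> \<C> \<Longrightarrow> closed C"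
    and sup: "is_pattern_sup Pat cutoff (cutoff A ` \<C>) S"
    and exhaust: "supp cutoff A \<subseteq> (\<Union>C\<in>\<C>. supp cutoff (cutoff A C))"
  shows "S = A"
proof (rule pattern_ge_eqI)
  show S: "S \<in> Pat" and A: "A \<in> Pat"
    using sup assms(1) by (auto simp: is_pattern_sup_def)
  show "pattern_ge cutoff A S"
    using sup assms(1,2) pattern_ge_cutoff[OF A] by (auto simp: is_pattern_sup_def)
  have "supp cutoff (cutoff A C) \<subseteq> supp cutoff S" if "C \<in> \<C>" for C
    using that sup S A assms(2) by (intro supp_mono cutoff_in) (auto simp: is_pattern_sup_def)
  then show "supp cutoff A \<subseteq> supp cutoff S"
    using exhaust by blast
qed

lemma act_inverse:
  assumes "g \<in> carrier G"
  shows "act g (act (inv g) x) = x"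
proof -
  interpret group G
    using space.group_hom group_hom.axioms(1) by auto
  show "act g (act (inv g) x) = x"
    using assms space.orbit_sym_aux[of "inv g" x] by simp
qed

lemma pact_mult_inverse:
  assumes "k \<in> carrier G" "g \<in> carrier G" "P \<in> Pat"
  shows "pact k (pact (inv k \<otimes> g) P) = pact g P"
proof -
  interpret group G
    using space.group_hom group_hom.axioms(1) by auto
  have "pact k (pact (inv k \<otimes> g) P) = pact (k \<otimes> (inv k \<otimes> g)) P"
    using assms by (simp add: patterns.composition_rule)
  also have "k \<otimes> (inv k \<otimes> g) = g"
    using assms by (simp add: m_assoc[symmetric])
  finally show ?thesis .
qed

lemma pact_in:
  assumes "g \<in> carrier G" "P \<in> Pat"
  shows "pact g P \<in> Pat"
  using patterns.element_image[OF assms] by simp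

lemma pact_eq_iff:
  assumes "g \<in> carrier G" "P \<in> Pat" "Q \<in> Pat"
  shows "pact g P = pact g Q \<longleftrightarrow> P = Q"
  using patterns.inj_prop[OF assms(1)] assms(2,3) by (auto dest: inj_onD)

lemma closed_act_image:
  assumes "g \<in> carrier G"
  shows "closed (act g ` C) \<longleftrightarrow> closed C"
  using homeomorphic_map_closedness[OF act_homeo[OF assms], of C] by simp

lemma cutoff_translate_eq_iff:
  assumes "g \<in> carrier G" "P \<in> Pat" "Q \<in> Pat" "closed C"
  shows "cutoff (pact g P) (act g ` C) = cutoff (pact g Q) (act g ` C) \<longleftrightarrow> cutoff P C = cutoff Q C"
  using assms by (simp add: cutoff_equivariant pact_eq_iff cutoff_in)

lemma closed_act_imageE:
  assumes "g \<in> carrier G" "closed C"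
  obtains D where "closed D" "C = act g ` D"
proof
  interpret group G
    using space.group_hom group_hom.axioms(1) by auto
  show "closed (act (inv g) ` C)"
    using assms by (simp add: closed_act_image)
  show "C = act g ` act (inv g) ` C"
    using assms by (simp add: image_image act_inverse)
qed

lemma supp_translate:
  assumes "g \<in> carrier G" "P \<in> Pat"
  shows "supp cutoff (pact g P) = act g ` supp cutoff P"
proof (rule supp_eqI)
  show "pact g P \<in> Pat" "closed (act g ` supp cutoff P)"
    using assms by (simp_all add: pact_in closed_act_image closed_supp)
next
  fix C :: "'x set" assume "closed C"
  then obtain D where D: "closed D" "C = act g ` D"
    using closed_act_imageE[OF assms(1)] by blast
  have "cutoff (pact g P) C = pact g P \<longleftrightarrow> cutoff P D = P"
    using assms D by (simp add: cutoff_equivariant pact_eq_iff cutoff_in)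
  also have "\<dots> \<longleftrightarrow> supp cutoff P \<subseteq> D"
    using assms D by (simp add: cutoff_eq_iff)
  also have "\<dots> \<longleftrightarrow> act g ` supp cutoff P \<subseteq> C"
    using D space.inj_prop[OF assms(1)] by (simp add: inj_image_subset_iff)
  finally show "cutoff (pact g P) C = pact g P \<longleftrightarrow> act g ` supp cutoff P \<subseteq> C" .
qed

end

section \<open>Isometric translation and bounded components\<close>

lemma isometric_act_cball:
  assumes "proper_isometric_action G act" "abstract_pattern_space G act Pat cutoff pact"
    and "g \<in> carrier G"
  shows "act g ` cball x r = cball (act g x) r"
proof -
  interpret abstract_pattern_space G act Pat cutoff pact by fact
  have iso: "dist (act g u) (act g v) = dist u v" for u v
    using assms by (simp add: proper_isometric_action_def)
  have "y \<in> act g ` cball x r" if "dist (act g x) y \<le> r" for y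
  proof (rule image_eqI)
    show "y = act g (act (inv\<^bsub>G\<^esub> g) y)"
      using assms(3) by (simp add: act_inverse)
    then show "act (inv\<^bsub>G\<^esub> g) y \<in> cball x r"
      using iso[of x "act (inv\<^bsub>G\<^esub> g) y"] that by simp
  qed
  then show ?thesis using iso by auto
qed

text \<open>
  Isometries carry balls to balls of the same radius, so one radius serves all translates of a
  pattern.
\<close>

lemma bounded_components_translate:
  assumes "proper_isometric_action G act" "abstract_pattern_space G act Pat cutoff pact"
    and "g \<in> carrier G" "P \<in> Pat" "closed C"
    and radius: "\<And>C x. \<lbrakk>closed C; x \<in> supp cutoff (cutoff P C)\<rbrakk>
      \<Longrightarrow> x \<in> supp cutoff (cutoff (cutoff P C) (cball x \<rho>))"
    and x: "x \<in> supp cutoff (cutoff (pact g P) C)"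
  shows "x \<in> supp cutoff (cutoff (cutoff (pact g P) C) (cball x \<rho>))"
proof -
  interpret abstract_pattern_space G act Pat cutoff pact by fact
  obtain D where D: "closed D" "C = act g ` D"
    using closed_act_imageE[OF assms(3,5)] by blast
  have eq: "cutoff (pact g P) C = pact g (cutoff P D)"
    using assms(3,4) D by (simp add: cutoff_equivariant)
  then have "x \<in> act g ` supp cutoff (cutoff P D)"
    using x assms(3,4) D by (simp add: supp_translate cutoff_in)
  then obtain z where z: "z \<in> supp cutoff (cutoff P D)" "x = act g z"
    by blast
  have "cutoff (pact g (cutoff P D)) (cball x \<rho>) = pact g (cutoff (cutoff P D) (cball z \<rho>))"
    using assms(3,4) D isometric_act_cball[OF assms(1-3)] z(2)
    by (metis closed_cball cutoff_equivariant cutoff_in)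
  then show ?thesis
    using radius[OF D(1) z(1)] z(2) assms(3,4) D(1) eq
    by (simp add: supp_translate cutoff_in)
qed

text \<open>
  The number \<open>1\<close> is arbitrary slack: a finite \<open>1\<close>-net of \<open>K\<close> exists by compactness, and the
  \<open>\<rho>\<close>-ball about any point of \<open>K\<close> lies in the \<open>(\<rho> + 1)\<close>-ball about some point of the net. Local
  finiteness, which glueability asks for, comes from the finiteness of the net, and compatibility
  holds since all pieces come from one pattern.
\<close>

lemma eq_if_locally_eq:
  assumes "abstract_pattern_space G act Pat cutoff pact" "glueable Pat cutoff"
    and AB: "A \<in> Pat" "B \<in> Pat"
    and "compact K" and supp_K: "supp cutoff A \<subseteq> K" "supp cutoff B \<subseteq> K"
    and radius_A: "\<And>x. x \<in> supp cutoff A \<Longrightarrow> x \<in> supp cutoff (cutoff A (cball x \<rho>))"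
    and radius_B: "\<And>x. x \<in> supp cutoff B \<Longrightarrow> x \<in> supp cutoff (cutoff B (cball x \<rho>))"
    and local_eq: "\<And>y. y \<in> K \<Longrightarrow> cutoff A (cball y (\<rho> + 1)) = cutoff B (cball y (\<rho> + 1))"
  shows "A = B"
proof -
  interpret abstract_pattern_space G act Pat cutoff pact by fact
  obtain F where F: "finite F" "F \<subseteq> K" "K \<subseteq> (\<Union>y\<in>F. ball y 1)"
    using seq_compact_imp_totally_bounded[OF compact_imp_seq_compact[OF \<open>compact K\<close>]]
    by (metis zero_less_one)
  define \<C> where "\<C> = (\<lambda>y. cball y (\<rho> + 1)) ` F"
  have closed_\<C>: "closed C" if "C \<in> \<C>" for C
    using that by (auto simp: \<C>_def)
  have pieces_eq: "cutoff A ` \<C> = cutoff B ` \<C>"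
    using local_eq F(2) by (force simp: \<C>_def image_image intro!: image_cong)
  have exhaust: "supp cutoff Q \<subseteq> (\<Union>C\<in>\<C>. supp cutoff (cutoff Q C))"
    if Q: "Q \<in> Pat" "supp cutoff Q \<subseteq> K"
      and radius: "\<And>x. x \<in> supp cutoff Q \<Longrightarrow> x \<in> supp cutoff (cutoff Q (cball x \<rho>))" for Q
  proof
    fix x assume x: "x \<in> supp cutoff Q"
    then obtain y where y: "y \<in> F" "dist y x < 1"
      using F(3) Q(2) by (auto simp: subset_iff)
    have "cball x \<rho> \<subseteq> cball y (\<rho> + 1)"
    proof
      fix z assume "z \<in> cball x \<rho>"
      then show "z \<in> cball y (\<rho> + 1)"
        using y(2) dist_triangle[of y z x] by simp
    qed
    then have "x \<in> supp cutoff (cutoff Q (cball y (\<rho> + 1)))"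
      using radius[OF x] supp_cutoff_mono[OF Q(1)] by (meson closed_cball subsetD)
    then show "x \<in> (\<Union>C\<in>\<C>. supp cutoff (cutoff Q C))"
      using y(1) by (auto simp: \<C>_def)
  qed
  have "cutoff A ` \<C> \<subseteq> Pat" "locally_finite_patterns cutoff (cutoff A ` \<C>)"
    "pairwise_compatible Pat cutoff (cutoff A ` \<C>)"
    using AB(1) closed_\<C> F(1)
    by (auto simp: locally_finite_patterns_def pairwise_compatible_def \<C>_def
        intro!: cutoff_in bexI[of _ A] pattern_ge_cutoff)
  then obtain S where S: "is_pattern_sup Pat cutoff (cutoff A ` \<C>) S"
    using assms(2) by (auto simp: glueable_def)
  have "S = A"
    using pattern_sup_of_pieces[OF AB(1) closed_\<C> S] exhaust[OF AB(1) supp_K(1) radius_A] by blast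
  moreover have "S = B"
    using pattern_sup_of_pieces[OF AB(2) closed_\<C> S[unfolded pieces_eq]]
      exhaust[OF AB(2) supp_K(2) radius_B] by blast
  ultimately show ?thesis by simp
qed

section \<open>The three forms of local derivability\<close>

lemma derivable_all_bases_imp_some_base:
  assumes "derivable_all_bases G cutoff1 pact1 P1 cutoff2 pact2 P2"
  shows "derivable_some_base G cutoff1 pact1 P1 cutoff2 pact2 P2"
  using assms unfolding derivable_all_bases_def derivable_some_base_def by meson

lemma cball_subset_cball_shift:
  fixes x y :: "'a::metric_space"
  assumes "dist x y + r \<le> s"
  shows "cball y r \<subseteq> cball x s"
proof
  fix z assume "z \<in> cball y r"
  then show "z \<in> cball x s"
    using assms dist_triangle[of x z y] by simp
qed

lemma derivable_some_base_imp_all_bases: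
  assumes "abstract_pattern_space G actX Pat1 cutoff1 pact1" "P1 \<in> Pat1"
    and "abstract_pattern_space G actY Pat2 cutoff2 pact2" "P2 \<in> Pat2"
    and "derivable_some_base G cutoff1 pact1 P1 cutoff2 pact2 P2"
  shows "derivable_all_bases G cutoff1 pact1 P1 cutoff2 pact2 P2"
  unfolding derivable_all_bases_def
proof (intro allI)
  fix x1 y1
  interpret p1: abstract_pattern_space G actX Pat1 cutoff1 pact1 by fact
  interpret p2: abstract_pattern_space G actY Pat2 cutoff2 pact2 by fact
  obtain x0 y0 R0 where R0: "R0 \<ge> 0"
    and base0: "\<And>g h R. \<lbrakk>g \<in> carrier G; h \<in> carrier G; R \<ge> 0;
        cutoff1 (pact1 g P1) (cball x0 (R + R0)) = cutoff1 (pact1 h P1) (cball x0 (R + R0))\<rbrakk>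
      \<Longrightarrow> cutoff2 (pact2 g P2) (cball y0 R) = cutoff2 (pact2 h P2) (cball y0 R)"
    using assms(5) unfolding derivable_some_base_def by blast
  let ?R1 = "R0 + dist x1 x0 + dist y0 y1"
  show "\<exists>R1\<ge>0. \<forall>g\<in>carrier G. \<forall>h\<in>carrier G. \<forall>R\<ge>0.
      cutoff1 (pact1 g P1) (cball x1 (R + R1)) = cutoff1 (pact1 h P1) (cball x1 (R + R1)) \<longrightarrow>
      cutoff2 (pact2 g P2) (cball y1 R) = cutoff2 (pact2 h P2) (cball y1 R)"
  proof (intro exI[of _ ?R1] conjI ballI allI impI)
    show "?R1 \<ge> 0" using R0 by simp
  next
    fix g h and R :: real
    assume gh: "g \<in> carrier G" "h \<in> carrier G" and R: "R \<ge> 0"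
      and eq: "cutoff1 (pact1 g P1) (cball x1 (R + ?R1)) = cutoff1 (pact1 h P1) (cball x1 (R + ?R1))"
    let ?R = "R + dist y0 y1"
    have "cball x0 (?R + R0) \<subseteq> cball x1 (R + ?R1)"
      by (rule cball_subset_cball_shift) simp
    then have "cutoff1 (pact1 g P1) (cball x0 (?R + R0)) = cutoff1 (pact1 h P1) (cball x0 (?R + R0))"
      using p1.cutoff_eq_subset[OF _ _ _ _ _ eq] gh assms(2) by (simp add: p1.pact_in)
    then have "cutoff2 (pact2 g P2) (cball y0 ?R) = cutoff2 (pact2 h P2) (cball y0 ?R)"
      using base0[OF gh, of ?R] R by simp
    moreover have "cball y1 R \<subseteq> cball y0 ?R"
      by (rule cball_subset_cball_shift) simp
    ultimately show "cutoff2 (pact2 g P2) (cball y1 R) = cutoff2 (pact2 h P2) (cball y1 R)"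
      using p2.cutoff_eq_subset[of _ _ "cball y0 ?R" "cball y1 R"] gh assms(4) by (simp add: p2.pact_in)
  qed
qed

lemma derivable_some_base_imp_compact:
  fixes actX :: "'g \<Rightarrow> 'x::metric_space \<Rightarrow> 'x" and actY :: "'g \<Rightarrow> 'y::metric_space \<Rightarrow> 'y"
  assumes "proper_isometric_action G actX"
    and "abstract_pattern_space G actY Pat2 cutoff2 pact2" "P2 \<in> Pat2"
    and "derivable_some_base G cutoff1 pact1 P1 cutoff2 pact2 P2"
  shows "derivable_compact G (cutoff1 :: 'p \<Rightarrow> 'x set \<Rightarrow> 'p) pact1 P1 cutoff2 pact2 P2"
  unfolding derivable_compact_def
proof (intro allI impI)
  fix K2 :: "'y set" assume K2: "compact K2"
  interpret p2: abstract_pattern_space G actY Pat2 cutoff2 pact2 by fact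
  obtain x0 y0 R0 where
    base0: "\<And>g h R. \<lbrakk>g \<in> carrier G; h \<in> carrier G; R \<ge> 0;
        cutoff1 (pact1 g P1) (cball x0 (R + R0)) = cutoff1 (pact1 h P1) (cball x0 (R + R0))\<rbrakk>
      \<Longrightarrow> cutoff2 (pact2 g P2) (cball y0 R) = cutoff2 (pact2 h P2) (cball y0 R)"
    using assms(4) unfolding derivable_some_base_def by blast
  obtain R where R: "R \<ge> 0" "K2 \<subseteq> cball y0 R"
    using bounded_subset_ballD[OF compact_imp_bounded[OF K2], of y0] ball_subset_cball[of y0]
    by (metis less_imp_le subset_trans)
  show "\<exists>K1. compact K1 \<and> (\<forall>g\<in>carrier G. \<forall>h\<in>carrier G.
      cutoff1 (pact1 g P1) K1 = cutoff1 (pact1 h P1) K1 \<longrightarrow>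
      cutoff2 (pact2 g P2) K2 = cutoff2 (pact2 h P2) K2)"
  proof (intro exI[of _ "cball x0 (R + R0)"] conjI ballI impI)
    show "compact (cball x0 (R + R0))"
      using assms(1) by (simp add: proper_isometric_action_def)
  next
    fix g h
    assume gh: "g \<in> carrier G" "h \<in> carrier G"
      and eq: "cutoff1 (pact1 g P1) (cball x0 (R + R0)) = cutoff1 (pact1 h P1) (cball x0 (R + R0))"
    show "cutoff2 (pact2 g P2) K2 = cutoff2 (pact2 h P2) K2"
      using p2.cutoff_eq_subset[OF _ _ _ _ R(2) base0[OF gh R(1) eq]] gh assms(3) K2
      by (simp add: p2.pact_in compact_imp_closed)
  qed
qed

text \<open>
  Transitivity moves a local rule with centre \<open>x0\<close> to any other centre: if \<open>k\<close> takes \<open>x0\<close> to \<open>y\<close>,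
  apply the rule to the translates by \<open>inv k \<otimes> g\<close> and \<open>inv k \<otimes> h\<close>.
\<close>

lemma local_rule_every_centre:
  fixes act :: "'g \<Rightarrow> 'x::metric_space \<Rightarrow> 'x"
  assumes "proper_isometric_action G act" "transitive_action G UNIV act"
    and "abstract_pattern_space G act Pat1 cutoff1 pact1" "P1 \<in> Pat1"
    and "abstract_pattern_space G act Pat2 cutoff2 pact2" "P2 \<in> Pat2"
    and rule: "\<And>g h. \<lbrakk>g \<in> carrier G; h \<in> carrier G;
        cutoff1 (pact1 g P1) (cball x0 s) = cutoff1 (pact1 h P1) (cball x0 s)\<rbrakk>
      \<Longrightarrow> cutoff2 (pact2 g P2) (cball x0 r) = cutoff2 (pact2 h P2) (cball x0 r)"
    and gh: "g \<in> carrier G" "h \<in> carrier G"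
    and eq: "cutoff1 (pact1 g P1) (cball y s) = cutoff1 (pact1 h P1) (cball y s)"
  shows "cutoff2 (pact2 g P2) (cball y r) = cutoff2 (pact2 h P2) (cball y r)"
proof -
  interpret p1: abstract_pattern_space G act Pat1 cutoff1 pact1 by fact
  interpret p2: abstract_pattern_space G act Pat2 cutoff2 pact2 by fact
  interpret group G
    using p1.space.group_hom group_hom.axioms(1) by auto
  obtain k where k: "k \<in> carrier G" "act k x0 = y"
    using transitive_action.unique_orbit[OF assms(2), of x0 y] by auto
  let ?g = "inv\<^bsub>G\<^esub> k \<otimes>\<^bsub>G\<^esub> g" and ?h = "inv\<^bsub>G\<^esub> k \<otimes>\<^bsub>G\<^esub> h"
  have gh': "?g \<in> carrier G" "?h \<in> carrier G"
    using gh k by simp_all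
  have ball: "cball y t = act k ` cball x0 t" for t
    using isometric_act_cball[OF assms(1,3) k(1)] k(2) by simp
  have "cutoff1 (pact1 ?g P1) (cball x0 s) = cutoff1 (pact1 ?h P1) (cball x0 s)"
    using eq p1.cutoff_translate_eq_iff[of k "pact1 ?g P1" "pact1 ?h P1" "cball x0 s"] k gh gh' assms(4)
    by (simp add: ball p1.pact_in p1.pact_mult_inverse)
  then have "cutoff2 (pact2 ?g P2) (cball x0 r) = cutoff2 (pact2 ?h P2) (cball x0 r)"
    by (rule rule[OF gh'])
  then show ?thesis
    using p2.cutoff_translate_eq_iff[of k "pact2 ?g P2" "pact2 ?h P2" "cball x0 r"] k gh gh' assms(6)
    by (simp add: ball p2.pact_in p2.pact_mult_inverse)
qed

lemma derivable_compact_imp_some_base: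
  fixes act :: "'g \<Rightarrow> 'x::metric_space \<Rightarrow> 'x"
  assumes "proper_isometric_action G act" "transitive_action G UNIV act"
    and "abstract_pattern_space G act Pat1 cutoff1 pact1" "P1 \<in> Pat1"
    and "abstract_pattern_space G act Pat2 cutoff2 pact2" "P2 \<in> Pat2"
    and "glueable Pat2 cutoff2" "bounded_components cutoff2 P2"
    and "derivable_compact G cutoff1 pact1 P1 cutoff2 pact2 P2"
  shows "derivable_some_base G cutoff1 pact1 P1 cutoff2 pact2 P2"
proof -
  interpret p1: abstract_pattern_space G act Pat1 cutoff1 pact1 by fact
  interpret p2: abstract_pattern_space G act Pat2 cutoff2 pact2 by fact
  have compact_cball: "compact (cball x r)" for x :: 'x and r
    using assms(1) by (simp add: proper_isometric_action_def)
  obtain \<rho> where radius: "\<And>C x. \<lbrakk>closed C; x \<in> supp cutoff2 (cutoff2 P2 C)\<rbrakk>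
      \<Longrightarrow> x \<in> supp cutoff2 (cutoff2 (cutoff2 P2 C) (cball x \<rho>))"
    using assms(8) unfolding bounded_components_def by blast
  \<comment> \<open>The centre is arbitrary, because the action is transitive.\<close>
  define x0 :: 'x where "x0 = undefined"
  obtain K1 where K1: "compact K1" and
    rule1: "\<And>g h. \<lbrakk>g \<in> carrier G; h \<in> carrier G; cutoff1 (pact1 g P1) K1 = cutoff1 (pact1 h P1) K1\<rbrakk>
      \<Longrightarrow> cutoff2 (pact2 g P2) (cball x0 (\<rho> + 1)) = cutoff2 (pact2 h P2) (cball x0 (\<rho> + 1))"
    using assms(9) compact_cball[of x0 "\<rho> + 1"] unfolding derivable_compact_def by meson
  obtain R0 where R0: "R0 \<ge> 0" "K1 \<subseteq> cball x0 R0"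
    using bounded_subset_ballD[OF compact_imp_bounded[OF K1], of x0] ball_subset_cball[of x0]
    by (metis less_imp_le subset_trans)
  have rule: "cutoff2 (pact2 g P2) (cball x0 (\<rho> + 1)) = cutoff2 (pact2 h P2) (cball x0 (\<rho> + 1))"
    if gh: "g \<in> carrier G" "h \<in> carrier G"
      and eq: "cutoff1 (pact1 g P1) (cball x0 R0) = cutoff1 (pact1 h P1) (cball x0 R0)" for g h
    using p1.cutoff_eq_subset[OF _ _ _ _ R0(2) eq] gh assms(4) K1
    by (intro rule1) (simp_all add: p1.pact_in compact_imp_closed)
  show ?thesis
    unfolding derivable_some_base_def
  proof (intro exI[of _ x0] exI[of _ R0] conjI ballI allI impI)
    show "R0 \<ge> 0" by (fact R0(1))
  next
    fix g h and R :: real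
    assume gh: "g \<in> carrier G" "h \<in> carrier G"
      and eq: "cutoff1 (pact1 g P1) (cball x0 (R + R0)) = cutoff1 (pact1 h P1) (cball x0 (R + R0))"
    let ?B = "cball x0 R"
    have local: "cutoff2 (pact2 g P2) (cball y (\<rho> + 1)) = cutoff2 (pact2 h P2) (cball y (\<rho> + 1))"
      if y: "y \<in> ?B" for y
    proof (rule local_rule_every_centre[OF assms(1-6) _ gh])
      have "cball y R0 \<subseteq> cball x0 (R + R0)"
        using y by (intro cball_subset_cball_shift) simp
      then show "cutoff1 (pact1 g P1) (cball y R0) = cutoff1 (pact1 h P1) (cball y R0)"
        using p1.cutoff_eq_subset[OF _ _ _ _ _ eq] gh assms(4) by (simp add: p1.pact_in)
    qed (rule rule)
    show "cutoff2 (pact2 g P2) ?B = cutoff2 (pact2 h P2) ?B"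
    proof (rule eq_if_locally_eq[OF assms(5,7), where K = ?B and \<rho> = \<rho>])
      show "x \<in> supp cutoff2 (cutoff2 (cutoff2 (pact2 g P2) ?B) (cball x \<rho>))"
        if "x \<in> supp cutoff2 (cutoff2 (pact2 g P2) ?B)" for x
        by (rule bounded_components_translate[OF assms(1,5) gh(1) assms(6) closed_cball _ that], rule radius)
      show "x \<in> supp cutoff2 (cutoff2 (cutoff2 (pact2 h P2) ?B) (cball x \<rho>))"
        if "x \<in> supp cutoff2 (cutoff2 (pact2 h P2) ?B)" for x
        by (rule bounded_components_translate[OF assms(1,5) gh(2) assms(6) closed_cball _ that], rule radius)
      show "cutoff2 (cutoff2 (pact2 g P2) ?B) (cball y (\<rho> + 1)) =
          cutoff2 (cutoff2 (pact2 h P2) ?B) (cball y (\<rho> + 1))" if "y \<in> ?B" for y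
        using local[OF that] gh assms(6)
        by (metis closed_cball inf_commute p2.cutoff_cutoff p2.pact_in)
    qed (use gh assms(6) compact_cball in
        \<open>simp_all add: p2.pact_in p2.cutoff_in p2.supp_cutoff_subset\<close>)
  qed
qed

theorem lemma3p16:
  fixes G :: "('g, 'm) monoid_scheme"
    and actX :: "'g \<Rightarrow> 'x::metric_space \<Rightarrow> 'x"
    and Pat1 :: "'p set" and cutoff1 :: "'p \<Rightarrow> 'x set \<Rightarrow> 'p" and pact1 :: "'g \<Rightarrow> 'p \<Rightarrow> 'p" and P1 :: 'p
  assumes "proper_isometric_action G actX"
    and "abstract_pattern_space G actX Pat1 cutoff1 pact1"
    and "P1 \<in> Pat1"
  shows
    "(\<forall>(actY :: 'g \<Rightarrow> 'y::metric_space \<Rightarrow> 'y)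
        (Pat2 :: 'q set) (cutoff2 :: 'q \<Rightarrow> 'y set \<Rightarrow> 'q) pact2 P2.
        proper_isometric_action G actY \<and>
        abstract_pattern_space G actY Pat2 cutoff2 pact2 \<and> P2 \<in> Pat2 \<longrightarrow>
          (derivable_some_base G cutoff1 pact1 P1 cutoff2 pact2 P2 \<longleftrightarrow>
           derivable_all_bases G cutoff1 pact1 P1 cutoff2 pact2 P2) \<and>
          (derivable_some_base G cutoff1 pact1 P1 cutoff2 pact2 P2 \<longrightarrow>
           derivable_compact G cutoff1 pact1 P1 cutoff2 pact2 P2) \<and>
          (derivable_all_bases G cutoff1 pact1 P1 cutoff2 pact2 P2 \<longrightarrow>
           derivable_compact G cutoff1 pact1 P1 cutoff2 pact2 P2)) \<and>
     (\<forall>(Pat2 :: 'q set) (cutoff2 :: 'q \<Rightarrow> 'x set \<Rightarrow> 'q) pact2 P2.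
        abstract_pattern_space G actX Pat2 cutoff2 pact2 \<and> P2 \<in> Pat2 \<and>
        transitive_action G (UNIV :: 'x set) actX \<and>
        glueable Pat2 cutoff2 \<and> bounded_components cutoff2 P2 \<longrightarrow>
          derivable_compact G cutoff1 pact1 P1 cutoff2 pact2 P2 \<longrightarrow>
            derivable_some_base G cutoff1 pact1 P1 cutoff2 pact2 P2 \<and>
            derivable_all_bases G cutoff1 pact1 P1 cutoff2 pact2 P2)"
proof (intro conjI allI impI; (elim conjE)?)
  fix actY :: "'g \<Rightarrow> 'y \<Rightarrow> 'y" and Pat2 :: "'q set" and cutoff2 pact2 P2
  assume Y: "abstract_pattern_space G actY Pat2 cutoff2 pact2" "P2 \<in> Pat2"
  show "derivable_some_base G cutoff1 pact1 P1 cutoff2 pact2 P2 \<longleftrightarrow>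
      derivable_all_bases G cutoff1 pact1 P1 cutoff2 pact2 P2"
    using derivable_some_base_imp_all_bases[OF assms(2,3) Y] derivable_all_bases_imp_some_base
    by (rule iffI)
  show compact: "derivable_compact G cutoff1 pact1 P1 cutoff2 pact2 P2"
    if "derivable_some_base G cutoff1 pact1 P1 cutoff2 pact2 P2"
    using derivable_some_base_imp_compact[OF assms(1) Y that] .
  show "derivable_compact G cutoff1 pact1 P1 cutoff2 pact2 P2"
    if "derivable_all_bases G cutoff1 pact1 P1 cutoff2 pact2 P2"
    using compact[OF derivable_all_bases_imp_some_base[OF that]] .
next
  fix Pat2 :: "'q set" and cutoff2 :: "'q \<Rightarrow> 'x set \<Rightarrow> 'q" and pact2 P2
  assume p2: "abstract_pattern_space G actX Pat2 cutoff2 pact2" "P2 \<in> Pat2"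
    and trans: "transitive_action G (UNIV :: 'x set) actX"
    and comp: "glueable Pat2 cutoff2" "bounded_components cutoff2 P2"
      "derivable_compact G cutoff1 pact1 P1 cutoff2 pact2 P2"
  show some: "derivable_some_base G cutoff1 pact1 P1 cutoff2 pact2 P2"
    using derivable_compact_imp_some_base[OF assms(1) trans assms(2,3) p2 comp] .
  show "derivable_all_bases G cutoff1 pact1 P1 cutoff2 pact2 P2"
    using derivable_some_base_imp_all_bases[OF assms(2,3) p2 some] .
qed

end
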